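(* Let $K$ be a field of characteristic different from $2$, let $\mathcal C$ be the conic section and $\ell:\mathcal C(K)\to\mathbb P^1(K)$ the linear rational map, defined over $K$, described in the context, and let $\mathrm{Disc}(t)$, $x_1(t),x_2(t),x_0(t)$ be the associated expressions. Consider those $t_0\in K$ such that $\sqrt{\mathrm{Disc}(t_0)}\in K$ and $$k=\frac{\mathrm{Disc}'(t_0)^2-2\,\mathrm{Disc}(t_0)\,\mathrm{Disc}''(t_0)}{\mathrm{Disc}'(t_0)^2}\neq 0,\,1,\,\infty .$$ Then for each $K$-rational point $(X:Y:1)$ on the elliptic curve $$\mathcal E_k:\quad Y^2+4XY+4kY=X^3+kX^2,$$ the set $\{P_1,P_2,P_3\}$ with $$P_1=\bigl(x_1(t_0-\delta):x_2(t_0-\delta):x_0(t_0-\delta)\bigr),$$ $$P_2=\bigl(x_1(t_0):x_2(t_0):x_0(t_0)\bigr),$$ $$P_3=\bigl(x_1(t_0+\delta):x_2(t_0+\delta):x_0(t_0+\delta)\bigr),$$ where $$\delta=-\frac{\mathrm{Disc}(t_0)}{\mathrm{Disc}'(t_0)}\cdot\frac{4XY}{Y^2+2XY+kX^2},$$ is contained in $\mathbb P^2(K)$ and forms an arithmetic progression on $\mathcal C$ with respect to $\ell$, with common difference $\delta=\ell(P_2)-\ell(P_1)=\ell(P_3)-\ell(P_2)$.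
   Context: The conic section is $$\mathcal C=\{(x_1:x_2:x_0)\in\mathbb P^2 : A x_1^2+2B x_1x_2+C x_2^2+2D x_1x_0+2E x_2x_0+F x_0^2=0\},$$ and the linear rational map $\ell:\mathcal C(K)\to\mathbb P^1(K)$ is $$\ell(x_1:x_2:x_0)=\frac{a x_1+b x_2+c x_0}{d x_1+e x_2+f x_0},$$ with coefficients $A,B,C,D,E,F,a,b,c,d,e,f\in K$. A set $\{P_1,P_2,P_3\}\subseteq\mathbb P^2(K)$ forms an arithmetic progression on $\mathcal C$ with respect to $\ell$ if each $P_i\in\mathcal C(K)$ and there is a common difference $\delta=\ell(P_2)-\ell(P_1)=\ell(P_3)-\ell(P_2)$. The discriminant is the polynomial in $t$ $$\mathrm{Disc}(t)=\begin{bmatrix}a-dt\\ b-et\\ c-ft\end{bmatrix}^T\begin{bmatrix}E^2-CF & BF-DE & CD-BE\\ BF-DE & D^2-AF & AE-BD\\ CD-BE & AE-BD & B^2-AC\end{bmatrix}\begin{bmatrix}a-dt\\ b-et\\ c-ft\end{bmatrix},$$ with $\mathrm{Disc}'$, $\mathrm{Disc}''$ its first and second derivatives in $t$. The condition $\sqrt{\mathrm{Disc}(t_0)}\in K$ means that $\mathrm{Disc}(t_0)$ is a square in $K$. The coordinates are $$x_1(t)=B(b-et)(c-ft)-C(a-dt)(c-ft)-D(b-et)^2+E(a-dt)(b-et)\pm(b-et)\sqrt{\mathrm{Disc}(t)},$$ $$x_2(t)=-A(b-et)(c-ft)+B(a-dt)(c-ft)+D(a-dt)(b-et)-E(a-dt)^2\mp(a-dt)\sqrt{\mathrm{Disc}(t)},$$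 $$x_0(t)=A(b-et)^2-2B(a-dt)(b-et)+C(a-dt)^2,$$ where the upper signs are taken together or the lower signs are taken together.
   Formalization: The progression is claimed only for sign choices where none of the three coordinate triples is (0,0,0), since the formulas can give (0:0:0), which is no point of the projective plane; where Y^2+2XY+kX^2=0, δ is read as 0. *)

theory Defs
  imports "HOL-Analysis.Analysis" "HOL-Computational_Algebra.Computational_Algebra"
begin

section \<open>Projective spaces over a field\<close>

text \<open>
  The point \<open>(v\<^sub>1 : \<dots> : v\<^sub>n)\<close> is the set of all nonzero multiples of \<open>v\<close>.  For \<open>v = 0\<close> this set
  is \<open>{0}\<close>, which is not an element of \<open>proj_space\<close>.
\<close>

definition proj_point :: "'k::field ^ 'n \<Rightarrow> ('k ^ 'n) set" where
  "proj_point v = {c *s v | c. c \<noteq> 0}"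

definition proj_space :: "('k::field ^ 'n) set set" where
  "proj_space = {proj_point v | v. v \<noteq> 0}"

text \<open>The element \<open>t\<close> of \<open>K\<close>, seen as the point \<open>(t : 1)\<close> of the projective line.\<close>

definition affine_point :: "'k::field \<Rightarrow> ('k ^ 2) set" where
  "affine_point t = proj_point (vector [t, 1])"

section \<open>The conic section, the linear rational map, arithmetic progressions\<close>

text \<open>
  Vectors \<open>v :: 'k ^ 3\<close> are written in the order \<open>(x\<^sub>1 : x\<^sub>2 : x\<^sub>0)\<close>, so \<open>v $ 3\<close> is \<open>x\<^sub>0\<close>.
\<close>

definition conic_section ::
  "'k::field \<Rightarrow> 'k \<Rightarrow> 'k \<Rightarrow> 'k \<Rightarrow> 'k \<Rightarrow> 'k \<Rightarrow> ('k ^ 3) set set" where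
  "conic_section A B C D E F =
     {P \<in> proj_space. \<forall>v \<in> P.
        A * (v $ 1)^2 + 2 * B * (v $ 1) * (v $ 2) + C * (v $ 2)^2
        + 2 * D * (v $ 1) * (v $ 3) + 2 * E * (v $ 2) * (v $ 3) + F * (v $ 3)^2 = 0}"

text \<open>
  The map sends \<open>proj_point v\<close> to \<open>proj_point\<close> of the pair (numerator, denominator).  Where
  numerator and denominator both vanish, the value is \<open>{0}\<close>, which is not a point of the
  projective line and in particular not of the form \<open>affine_point t\<close>.
\<close>

definition linear_rational_map ::
  "'k::field \<Rightarrow> 'k \<Rightarrow> 'k \<Rightarrow> 'k \<Rightarrow> 'k \<Rightarrow> 'k \<Rightarrow> ('k ^ 3) set \<Rightarrow> ('k ^ 2) set" where
  "linear_rational_map a b c d e f P =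
     (\<lambda>v. vector [a * v $ 1 + b * v $ 2 + c * v $ 3, d * v $ 1 + e * v $ 2 + f * v $ 3]) ` P"

text \<open>
  The points may coincide (\<open>\<delta> = 0\<close>).  The differences make sense only if the three
  values of \<open>l\<close> are finite, which is part of the definition.
\<close>

definition arith_prog ::
  "('k::field ^ 3) set set \<Rightarrow> (('k ^ 3) set \<Rightarrow> ('k ^ 2) set) \<Rightarrow>
   ('k ^ 3) set \<Rightarrow> ('k ^ 3) set \<Rightarrow> ('k ^ 3) set \<Rightarrow> 'k \<Rightarrow> bool" where
  "arith_prog \<C> l P1 P2 P3 \<delta> \<longleftrightarrow>
     P1 \<in> \<C> \<and> P2 \<in> \<C> \<and> P3 \<in> \<C> \<and>
     (\<exists>t1 t2 t3. l P1 = affine_point t1 \<and> l P2 = affine_point t2 \<and> l P3 = affine_point t3 \<and>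
        \<delta> = t2 - t1 \<and> \<delta> = t3 - t2)"

section \<open>The discriminant and the parametrised points\<close>

definition Disc ::
  "'k::field \<Rightarrow> 'k \<Rightarrow> 'k \<Rightarrow> 'k \<Rightarrow> 'k \<Rightarrow> 'k \<Rightarrow>
   'k \<Rightarrow> 'k \<Rightarrow> 'k \<Rightarrow> 'k \<Rightarrow> 'k \<Rightarrow> 'k \<Rightarrow> 'k poly" where
  "Disc A B C D E F a b c d e f =
     (let n = (vector [[:a, -d:], [:b, -e:], [:c, -f:]] :: 'k poly ^ 3);
          M = (vector
            [vector [[:E^2 - C * F:], [:B * F - D * E:], [:C * D - B * E:]],
             vector [[:B * F - D * E:], [:D^2 - A * F:], [:A * E - B * D:]],
             vector [[:C * D - B * E:], [:A * E - B * D:], [:B^2 - A * C:]]] :: 'k poly ^ 3 ^ 3)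
      in \<Sum>i\<in>UNIV. n $ i * (M *v n) $ i)"

text \<open>
  The argument \<open>s\<close> stands for a square root of \<open>Disc(t)\<close>.  The two choices of sign correspond to
  the two square roots \<open>s\<close> and \<open>-s\<close>.
  The triple is homogeneous coordinates of a point only if it is nonzero.  It can vanish, but only
  if its third entry does, for instance when \<open>a - d*t = b - e*t = 0\<close>.
\<close>

definition coords ::
  "'k::field \<Rightarrow> 'k \<Rightarrow> 'k \<Rightarrow> 'k \<Rightarrow> 'k \<Rightarrow> 'k \<Rightarrow>
   'k \<Rightarrow> 'k \<Rightarrow> 'k \<Rightarrow> 'k \<Rightarrow> 'k \<Rightarrow> 'k \<Rightarrow> 'k \<Rightarrow> 'k \<Rightarrow> 'k ^ 3" where
  "coords A B C D E F a b c d e f t s = vector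
     [B * (b - e*t) * (c - f*t) - C * (a - d*t) * (c - f*t) - D * (b - e*t)^2
        + E * (a - d*t) * (b - e*t) + (b - e*t) * s,
      - A * (b - e*t) * (c - f*t) + B * (a - d*t) * (c - f*t) + D * (a - d*t) * (b - e*t)
        - E * (a - d*t)^2 - (a - d*t) * s,
      A * (b - e*t)^2 - 2 * B * (a - d*t) * (b - e*t) + C * (a - d*t)^2]"

end

theory Submission
  imports Defs
begin

text \<open>
  The points of the conic with \<open>\<ell> = t\<close> lie on the line with normal vector
  \<open>(a - dt, b - et, c - ft)\<close>; they are rational iff \<open>Disc(t)\<close> is a square.  All these lines pass
  through the base point \<open>w = (a, b, c) \<times> (d, e, f)\<close>, where \<open>\<ell>\<close> is undefined, and the discriminant
  of the quadratic polynomial \<open>Disc\<close> is a multiple of the value of the conic's form at \<open>w\<close>.  The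
  condition \<open>k \<noteq> 0\<close> makes this discriminant nonzero, hence keeps \<open>w\<close> off the conic.
  After scaling by \<open>Disc(t0)\<close>, the values of \<open>Disc\<close> at \<open>t0 \<plusminus> \<delta>\<close> become quartics in \<open>X, Y\<close>: one is
  identically a square, and the other is a square modulo the equation of the elliptic curve.
\<close>

definition conic_form :: "'k::field \<Rightarrow> 'k \<Rightarrow> 'k \<Rightarrow> 'k \<Rightarrow> 'k \<Rightarrow> 'k \<Rightarrow> 'k ^ 3 \<Rightarrow> 'k" where
  "conic_form A B C D E F v =
     A * (v $ 1)^2 + 2 * B * (v $ 1) * (v $ 2) + C * (v $ 2)^2
     + 2 * D * (v $ 1) * (v $ 3) + 2 * E * (v $ 2) * (v $ 3) + F * (v $ 3)^2"

lemma conic_form_scale: "conic_form A B C D E F (r *s v) = r^2 * conic_form A B C D E F v"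
  by (simp add: conic_form_def) algebra

lemma poly_Disc:
  "poly (Disc A B C D E F a b c d e f) t =
     (E^2 - C*F) * (a - d*t)^2 + (D^2 - A*F) * (b - e*t)^2 + (B^2 - A*C) * (c - f*t)^2
     + 2 * (B*F - D*E) * (a - d*t) * (b - e*t) + 2 * (C*D - B*E) * (a - d*t) * (c - f*t)
     + 2 * (A*E - B*D) * (b - e*t) * (c - f*t)"
  by (simp add: Disc_def Let_def sum_3 matrix_vector_mult_def vector_3) algebra

text \<open>With \<open>G\<close> the symmetric matrix of the conic, the matrix in
  \<open>Disc\<close> is \<open>- adj G\<close>. As \<open>adj (adj G) = det G * G\<close>, its Gram
  determinant on the normals \<open>(a, b, c)\<close> and \<open>(d, e, f)\<close> is
  \<open>det G\<close> times the form at their cross product; the discriminant is -4 times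
  this.\<close>

lemma Disc_quadratic:
  fixes A B C D E F a b c d e f :: "'k::field"
  obtains p q r where "Disc A B C D E F a b c d e f = [:p, q, r:]"
    and "q^2 - 4 * p * r =
      4 * (A * C * F + 2 * B * D * E - A * E^2 - C * D^2 - F * B^2)
        * - conic_form A B C D E F (vector [b*f - c*e, c*d - a*f, a*e - b*d])"
proof -
  define p where "p = (E^2 - C*F) * a^2 + (D^2 - A*F) * b^2 + (B^2 - A*C) * c^2
     + 2 * (B*F - D*E) * a * b + 2 * (C*D - B*E) * a * c + 2 * (A*E - B*D) * b * c"
  define q where "q = - 2 * ((E^2 - C*F) * a * d + (D^2 - A*F) * b * e + (B^2 - A*C) * c * f
     + (B*F - D*E) * (a * e + b * d) + (C*D - B*E) * (a * f + c * d) + (A*E - B*D) * (b * f + c * e))"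
  define r where "r = (E^2 - C*F) * d^2 + (D^2 - A*F) * e^2 + (B^2 - A*C) * f^2
     + 2 * (B*F - D*E) * d * e + 2 * (C*D - B*E) * d * f + 2 * (A*E - B*D) * e * f"
  show thesis
  proof
    show "Disc A B C D E F a b c d e f = [:p, q, r:]"
      unfolding Disc_def Let_def p_def q_def r_def
      by (simp add: sum_3 matrix_vector_mult_def vector_3 algebra_simps power2_eq_square)
    show "q^2 - 4 * p * r =
      4 * (A * C * F + 2 * B * D * E - A * E^2 - C * D^2 - F * B^2)
        * - conic_form A B C D E F (vector [b*f - c*e, c*d - a*f, a*e - b*d])"
      unfolding conic_form_def p_def q_def r_def vector_3 by algebra
  qed
qed

text \<open>Let \<nu> be the normal of the line and \<open>h = (e*t - b, a - d*t, 0)\<close> its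
  direction at infinity. Then \<open>coords\<close> is the cross product of \<nu> with
  \<open>G h + s (0, 0, 1)\<close>.\<close>

lemma coords_on_line:
  fixes A B C D E F a b c d e f t s :: "'k::field" and v :: "'k ^ 3"
  defines "v \<equiv> coords A B C D E F a b c d e f t s"
  shows "(a - d*t) * v $ 1 + (b - e*t) * v $ 2 + (c - f*t) * v $ 3 = 0"
  unfolding v_def coords_def vector_3 by algebra

text \<open>In the same notation \<open>coords\<close> is \<open>\<nu> \<times> G h - s h\<close>.
  The two summands are conjugate with respect to \<open>G\<close>, and the form at
  \<open>\<nu> \<times> G h\<close> is \<open>- Disc(t)\<close> times the form at \<open>h\<close>,
  so the total is \<open>s^2 - Disc(t)\<close> times the form at \<open>h\<close>.\<close>

lemma coords_on_conic:
  assumes "s^2 = poly (Disc A B C D E F a b c d e f) t"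
  shows "conic_form A B C D E F (coords A B C D E F a b c d e f t s) = 0"
proof -
  define l m n where "l = a - d*t" and "m = b - e*t" and "n = c - f*t"
  have "s^2 = (E^2 - C*F) * l^2 + (D^2 - A*F) * m^2 + (B^2 - A*C) * n^2
     + 2 * (B*F - D*E) * l * m + 2 * (C*D - B*E) * l * n + 2 * (A*E - B*D) * m * n"
    using assms by (simp add: poly_Disc l_def m_def n_def)
  then show ?thesis
    unfolding conic_form_def coords_def vector_3 l_def[symmetric] m_def[symmetric] n_def[symmetric]
    by algebra
qed

lemma no_base_point:
  fixes v :: "'k::field ^ 3"
  assumes "v \<noteq> 0" and "conic_form A B C D E F v = 0"
    and n1: "a * v $ 1 + b * v $ 2 + c * v $ 3 = 0"
    and n2: "d * v $ 1 + e * v $ 2 + f * v $ 3 = 0"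
  shows "conic_form A B C D E F (vector [b*f - c*e, c*d - a*f, a*e - b*d]) = 0"
proof -
  define w :: "'k ^ 3" where "w = vector [b*f - c*e, c*d - a*f, a*e - b*d]"
  have 12: "v $ 1 * w $ 2 = v $ 2 * w $ 1" and 13: "v $ 1 * w $ 3 = v $ 3 * w $ 1"
    and 23: "v $ 2 * w $ 3 = v $ 3 * w $ 2"
    using n1 n2 unfolding w_def vector_3 by algebra+
  \<comment> \<open>Proportionality of \<open>v\<close> and \<open>w\<close> in a form that stays
    valid for \<open>w = 0\<close>, when the two normals are dependent.\<close>
  have "v $ i *s w = w $ i *s v" for i
    using exhaust_3[of i] 12 13 23 by (auto simp: vec_eq_iff forall_3 mult.commute)
  then have "(v $ i)^2 * conic_form A B C D E F w = 0" for i
    using conic_form_scale[of A B C D E F "v $ i" w] conic_form_scale[of A B C D E F "w $ i" v]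
      assms(2) by simp
  then show ?thesis
    using assms(1) by (auto simp: vec_eq_iff w_def)
qed

lemma proj_point_in_conic_section:
  assumes "v \<noteq> 0" and "conic_form A B C D E F v = 0"
  shows "proj_point v \<in> conic_section A B C D E F"
proof -
  have "conic_form A B C D E F u = 0" if "u \<in> proj_point v" for u
    using that assms(2) by (auto simp: proj_point_def conic_form_scale)
  then show ?thesis
    using assms(1) by (auto simp: conic_section_def proj_space_def conic_form_def)
qed

lemma linear_rational_map_eq_affine_point:
  fixes v :: "'k::field ^ 3"
  assumes den: "d * v $ 1 + e * v $ 2 + f * v $ 3 \<noteq> 0"
    and num: "a * v $ 1 + b * v $ 2 + c * v $ 3 = t * (d * v $ 1 + e * v $ 2 + f * v $ 3)"
  shows "linear_rational_map a b c d e f (proj_point v) = affine_point t"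
proof -
  define y where "y = d * v $ 1 + e * v $ 2 + f * v $ 3"
  have "linear_rational_map a b c d e f (proj_point v)
      = (\<lambda>r. vector [a * (r * v $ 1) + b * (r * v $ 2) + c * (r * v $ 3),
                     d * (r * v $ 1) + e * (r * v $ 2) + f * (r * v $ 3)]) ` {r. r \<noteq> 0}"
    by (simp add: linear_rational_map_def proj_point_def setcompr_eq_image image_image)
  also have "\<dots> = (\<lambda>r. (r * y) *s vector [t, 1]) ` {r. r \<noteq> 0}"
  proof (rule image_cong[OF refl])
    fix r
    have "a * (r * v $ 1) + b * (r * v $ 2) + c * (r * v $ 3) = r * (t * y)"
      unfolding y_def num[symmetric] by algebra
    moreover have "d * (r * v $ 1) + e * (r * v $ 2) + f * (r * v $ 3) = r * y"
      unfolding y_def by algebra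
    ultimately show "vector [a * (r * v $ 1) + b * (r * v $ 2) + c * (r * v $ 3),
        d * (r * v $ 1) + e * (r * v $ 2) + f * (r * v $ 3)] = (r * y) *s (vector [t, 1] :: 'k ^ 2)"
      by (simp add: vec_eq_iff forall_2 vector_2)
  qed
  also have "\<dots> = (\<lambda>r. r *s vector [t, 1]) ` ((\<lambda>r. r * y) ` {r. r \<noteq> 0})"
    by (simp add: image_image)
  \<comment> \<open>Multiplication by the nonzero denominator \<open>y\<close> permutes the nonzero
    scalars, so the image is the whole projective point.\<close>
  also have "(\<lambda>r. r * y) ` {r. r \<noteq> 0} = {r. r \<noteq> 0}"
  proof (intro equalityI subsetI)
    fix r :: 'k assume "r \<in> {r. r \<noteq> 0}"
    then show "r \<in> (\<lambda>r. r * y) ` {r. r \<noteq> 0}"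
      using den by (intro image_eqI[of _ _ "r / y"]) (auto simp: y_def)
  qed (use den in \<open>auto simp: y_def\<close>)
  also have "(\<lambda>r. r *s vector [t, 1]) ` {r. r \<noteq> 0} = affine_point t"
    by (auto simp: affine_point_def proj_point_def)
  finally show ?thesis .
qed

text \<open>Incidence with the line makes the numerator \<open>t\<close> times the denominator. If
  the denominator vanished, so would the numerator, and the base point would lie on the
  conic.\<close>

lemma linear_rational_map_coords:
  fixes A B C D E F a b c d e f t s :: "'k::field" and v :: "'k ^ 3"
  defines "v \<equiv> coords A B C D E F a b c d e f t s"
  assumes sq: "s^2 = poly (Disc A B C D E F a b c d e f) t" and "v \<noteq> 0"
    and base: "conic_form A B C D E F (vector [b*f - c*e, c*d - a*f, a*e - b*d]) \<noteq> 0"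
  shows "linear_rational_map a b c d e f (proj_point v) = affine_point t"
proof (rule linear_rational_map_eq_affine_point)
  show num: "a * v $ 1 + b * v $ 2 + c * v $ 3 = t * (d * v $ 1 + e * v $ 2 + f * v $ 3)"
    using coords_on_line[where A=A and B=B and C=C and D=D and E=E and F=F
        and a=a and b=b and c=c and d=d and e=e and f=f and t=t and s=s] unfolding v_def by algebra
  show "d * v $ 1 + e * v $ 2 + f * v $ 3 \<noteq> 0"
    using no_base_point[OF \<open>v \<noteq> 0\<close> coords_on_conic[OF sq, folded v_def], of a b c d e f] num base
    by auto
qed

text \<open>\<open>D0\<close>, \<open>D1\<close>, \<open>D2\<close> are Taylor coefficients, so
  \<open>D2\<close> is half the second derivative. For \<open>\<delta> = - (D0 / D1) * z\<close> the
  two values become \<open>D0 * (1 \<plusminus> z + (1 - k) * z^2 / 4)\<close>.\<close>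

lemma quadratic_values_square:
  fixes X Y k u D0 D1 D2 :: "'k::field"
  assumes two: "(2::'k) \<noteq> 0" and D0: "D0 = u^2" and D1: "D1 \<noteq> 0"
    and k: "k = (D1^2 - 4 * D0 * D2) / D1^2"
    and curve: "Y^2 + 4 * X * Y + 4 * k * Y = X^3 + k * X^2"
    and \<delta>: "\<delta> = - (D0 / D1) * (4 * X * Y / (Y^2 + 2 * X * Y + k * X^2))"
  shows "is_square (D0 - D1 * \<delta> + D2 * \<delta>^2)" and "is_square (D0 + D1 * \<delta> + D2 * \<delta>^2)"
proof -
  define N where "N = Y^2 + 2 * X * Y + k * X^2"
  have "is_square (D0 - D1 * \<delta> + D2 * \<delta>^2) \<and> is_square (D0 + D1 * \<delta> + D2 * \<delta>^2)"
  proof (cases "N = 0")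
    \<comment> \<open>Division by zero yields \<open>\<delta> = 0\<close> here, and both values
      equal \<open>D0\<close>.\<close>
    case True
    then show ?thesis
      using D0 \<delta> by (auto simp: N_def)
  next
    case False
    define z where "z = 4 * X * Y / N"
    have zN: "z * N = 4 * X * Y" using False by (simp add: z_def)
    have lin: "D1 * \<delta> = - D0 * z" using D1 by (simp add: \<delta> z_def N_def)
    have kD: "4 * D0 * D2 = (1 - k) * D1^2" using D1 by (simp add: k field_simps)
    have "D1^2 * (4 * D2 * \<delta>^2) = 4 * D2 * (D1 * \<delta>)^2" by algebra
    also have "\<dots> = D1^2 * ((1 - k) * D0 * z^2)" unfolding lin using kD by algebra
    finally have quad: "4 * D2 * \<delta>^2 = (1 - k) * D0 * z^2" using D1 by simp
    have N_eq: "N = Y^2 + 2 * X * Y + k * X^2" by (fact N_def)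
    have four: "(4::'k) \<noteq> 0"
      using two by (metis mult_eq_0_iff numeral_Bit0 mult_2)
    have nz: "4 * N^2 \<noteq> 0" using four False by simp
    have root: "is_square W" if "4 * N^2 * W = 4 * (u * g)^2" for W g
    proof -
      have "W = (u * g / N)^2"
        using that four False by (simp add: field_simps power2_eq_square)
      then show ?thesis by auto
    qed
    have "4 * N^2 * (D0 + D1 * \<delta> + D2 * \<delta>^2)
        = D0 * (4 * N^2 - 4 * N * (z * N) + (1 - k) * (z * N)^2)"
      using lin quad by algebra
    \<comment> \<open>Here \<open>(N - 2*X*Y)^2 - 4*k*X^2*Y^2\<close> is
      \<open>(Y^2 + k*X^2)^2 - 4*k*X^2*Y^2\<close>, a square without using the curve.\<close>
    also have "\<dots> = 4 * (u * (Y^2 - k * X^2))^2"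
      unfolding zN unfolding D0 N_eq by algebra
    finally have plus: "is_square (D0 + D1 * \<delta> + D2 * \<delta>^2)" by (rule root)
    have "4 * N^2 * (D0 - D1 * \<delta> + D2 * \<delta>^2)
        = D0 * (4 * N^2 + 4 * N * (z * N) + (1 - k) * (z * N)^2)"
      using lin quad by algebra
    \<comment> \<open>The curve enters twice: as \<open>Y^2 + 4*X*Y - X^3 = k * (X^2 - 4*Y)\<close>
      and as \<open>(X^2 - 4*Y) * (X + k) = Y^2\<close>.\<close>
    also have "\<dots> = 4 * (u * (2 * X^3 + k * X^2 - Y^2 - 4 * X * Y))^2"
      unfolding zN unfolding D0 N_eq using curve by algebra
    finally show ?thesis using plus root by blast
  qed
  then show "is_square (D0 - D1 * \<delta> + D2 * \<delta>^2)" and "is_square (D0 + D1 * \<delta> + D2 * \<delta>^2)"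
    by blast+
qed

theorem mainTheorem1:
  fixes A B C D E F a b c d e f t0 k X Y \<delta> :: "'k::field"
    and \<Delta> :: "'k poly"
    and x :: "'k \<Rightarrow> 'k \<Rightarrow> 'k ^ 3"
  assumes char: "CHAR('k) \<noteq> 2"
    and \<Delta>: "\<Delta> = Disc A B C D E F a b c d e f"
    and x: "x = coords A B C D E F a b c d e f"
    and sqrt_t0: "is_square (poly \<Delta> t0)"
    and k: "k = ((poly (pderiv \<Delta>) t0)^2 - 2 * poly \<Delta> t0 * poly (pderiv (pderiv \<Delta>)) t0)
                / (poly (pderiv \<Delta>) t0)^2"
    and k_finite: "poly (pderiv \<Delta>) t0 \<noteq> 0"
    and k_0: "k \<noteq> 0" and k_1: "k \<noteq> 1"
    and curve: "Y^2 + 4 * X * Y + 4 * k * Y = X^3 + k * X^2"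
    and \<delta>: "\<delta> = - (poly \<Delta> t0 / poly (pderiv \<Delta>) t0)
                  * (4 * X * Y / (Y^2 + 2 * X * Y + k * X^2))"
  shows "is_square (poly \<Delta> (t0 - \<delta>)) \<and> is_square (poly \<Delta> (t0 + \<delta>)) \<and>
    (\<forall>s1 s2 s3.
       s1^2 = poly \<Delta> (t0 - \<delta>) \<and> s2^2 = poly \<Delta> t0 \<and> s3^2 = poly \<Delta> (t0 + \<delta>) \<and>
       x (t0 - \<delta>) s1 \<noteq> 0 \<and> x t0 s2 \<noteq> 0 \<and> x (t0 + \<delta>) s3 \<noteq> 0 \<longrightarrow>
       (let P1 = proj_point (x (t0 - \<delta>) s1);
            P2 = proj_point (x t0 s2);
            P3 = proj_point (x (t0 + \<delta>) s3)
        in {P1, P2, P3} \<subseteq> proj_space \<and>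
           arith_prog (conic_section A B C D E F) (linear_rational_map a b c d e f) P1 P2 P3 \<delta>))"
proof -
  have two: "(2::'k) \<noteq> 0"
  proof
    assume "(2::'k) = 0"
    then have "of_nat 2 = (0::'k)" by simp
    then have "CHAR('k) dvd 2" by (simp only: of_nat_eq_0_iff_char_dvd)
    moreover have "CHAR('k) \<noteq> 1" by simp
    ultimately show False
      using char by (metis prime_nat_iff two_is_prime_nat)
  qed
  obtain p q r where pqr: "\<Delta> = [:p, q, r:]"
    and disc: "q^2 - 4 * p * r =
      4 * (A * C * F + 2 * B * D * E - A * E^2 - C * D^2 - F * B^2)
        * - conic_form A B C D E F (vector [b*f - c*e, c*d - a*f, a*e - b*d])"
    using Disc_quadratic[of A B C D E F a b c d e f] unfolding \<Delta> by metis
  define D1 where "D1 = poly (pderiv \<Delta>) t0"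
  have D1: "D1 = q + 2 * r * t0" and D2: "poly (pderiv (pderiv \<Delta>)) t0 = 2 * r"
    by (simp_all add: D1_def pqr pderiv_pCons algebra_simps)
  have D0: "poly \<Delta> t0 = p + q * t0 + r * t0^2"
    by (simp add: pqr algebra_simps power2_eq_square)
  \<comment> \<open>The discriminant is invariant under translation to \<open>t0\<close>, so
    \<open>k * D1^2\<close> is the discriminant of \<open>\<Delta>\<close>.\<close>
  have "D1^2 - 2 * poly \<Delta> t0 * (2 * r) = q^2 - 4 * p * r"
    unfolding D1 D0 by algebra
  with k k_0 have "q^2 - 4 * p * r \<noteq> 0"
    by (auto simp: D1_def D2)
  with disc have base: "conic_form A B C D E F (vector [b*f - c*e, c*d - a*f, a*e - b*d]) \<noteq> 0"
    by auto
  obtain u where u: "poly \<Delta> t0 = u^2"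
    using sqrt_t0 by (auto elim: is_nth_powerE)
  have k': "k = (D1^2 - 4 * poly \<Delta> t0 * r) / D1^2"
    by (simp add: k D2 D1_def mult.assoc mult.left_commute)
  have taylor: "poly \<Delta> (t0 - \<delta>) = poly \<Delta> t0 - D1 * \<delta> + r * \<delta>^2"
      "poly \<Delta> (t0 + \<delta>) = poly \<Delta> t0 + D1 * \<delta> + r * \<delta>^2"
    unfolding D1 by (simp_all add: pqr algebra_simps power2_eq_square)
  note squares = quadratic_values_square[OF two u k_finite[folded D1_def] k' curve \<delta>[folded D1_def],
      folded taylor]
  \<comment> \<open>Valid for either root \<open>s\<close>, so the signs at the three points can be
    chosen independently.\<close>
  have point: "proj_point (x t s) \<in> proj_space"
      "proj_point (x t s) \<in> conic_section A B C D E F"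
      "linear_rational_map a b c d e f (proj_point (x t s)) = affine_point t"
    if "s^2 = poly \<Delta> t" "x t s \<noteq> 0" for t s
    using that proj_point_in_conic_section[OF _ coords_on_conic, of A B C D E F a b c d e f t s]
      linear_rational_map_coords[OF _ _ base, of s t]
    by (auto simp: x \<Delta> proj_space_def)
  have "arith_prog (conic_section A B C D E F) (linear_rational_map a b c d e f)
      (proj_point (x (t0 - \<delta>) s1)) (proj_point (x t0 s2)) (proj_point (x (t0 + \<delta>) s3)) \<delta>"
    if "s1^2 = poly \<Delta> (t0 - \<delta>)" "x (t0 - \<delta>) s1 \<noteq> 0" "s2^2 = poly \<Delta> t0" "x t0 s2 \<noteq> 0"
      "s3^2 = poly \<Delta> (t0 + \<delta>)" "x (t0 + \<delta>) s3 \<noteq> 0" for s1 s2 s3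
    unfolding arith_prog_def
    using point(2,3)[OF that(1,2)] point(2,3)[OF that(3,4)] point(2,3)[OF that(5,6)]
    by (intro conjI exI[of _ "t0 - \<delta>"] exI[of _ t0] exI[of _ "t0 + \<delta>"]) auto
  then show ?thesis
    using squares point(1) by (simp add: Let_def)
qed

end
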